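(* Assume the enhanced-tail same-gauge selector: for every intrinsic package $\mathcal D$ a representative $\zeta_\ast(\mathcal D)\in\Gamma_\Lambda^{\mathrm{int}}$ is fixed, $\mathcal D_\ast:=\mathcal D-\zeta_\ast(\mathcal D)$, and there is $\delta_{\mathrm{sel}}^\sharp\ge0$ such that for all $\mathcal D$ $$\|\mathcal D_\ast\|_{\mathrm{loc,int}}+\alpha_{\mathrm{proj}}\mathcal T_{\mathrm{proj}}(\mathcal D;\zeta_\ast)+\alpha_{\mathrm{harm}}\mathcal T_{\mathrm{harm}}(\mathcal D;\zeta_\ast)\le\operatorname{dist}^{\sharp,\mathrm{tail}}(\mathcal D)+\delta_{\mathrm{sel}}^\sharp.$$ Let $\Lambda_{\mathrm{adj}}=\{k\in\Lambda:k+1\in\Lambda\}$, and for $k\in\Lambda_{\mathrm{adj}}$ let $K_k^{\mathrm{rep}}:\mathfrak I_\Lambda^{\mathrm{loc}}\to Y_k^{\mathrm{rep}}$ be a bounded linear operator into a finite-dimensional normed space, with operator norm $C_k^{\mathrm{rep}}$. Define the reproduction drift residual $\mathcal R_{\mathrm{rep}}(\mathcal D)=\sum_{k\in\Lambda_{\mathrm{adj}}}\|K_k^{\mathrm{rep}}\mathcal D_\ast\|_{Y_k^{\mathrm{rep}}}$ and $C_{\mathrm{rep}}=\sum_{k\in\Lambda_{\mathrm{adj}}}C_k^{\mathrm{rep}}$. Then for every intrinsic package $\mathcal D$, $$\mathcal R_{\mathrm{rep}}(\mathcal D)\le C_{\mathrm{rep}}\operatorname{dist}^{\sharp,\mathrm{tail}}(\mathcal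 D)+C_{\mathrm{rep}}\delta_{\mathrm{sel}}^\sharp,$$ i.e. $\mathcal R_{\mathrm{rep}}(\mathcal D)\le\eta_{\mathrm{rep}}\operatorname{dist}^{\sharp,\mathrm{tail}}(\mathcal D)+\Delta_{\mathrm{rep}}$ with $\eta_{\mathrm{rep}}=C_{\mathrm{rep}}$ and $\Delta_{\mathrm{rep}}=C_{\mathrm{rep}}\delta_{\mathrm{sel}}^\sharp$. If the selector is an exact enhanced-tail minimizer, then one may take $\delta_{\mathrm{sel}}^\sharp=0$ and $\Delta_{\mathrm{rep}}=0$.
   Context: Intrinsic packages. $\Lambda$ is a finite set of consecutive integers. For $k\in\Lambda$, $j=1,\dots,7$, let $X_k^{(j)}$ be normed spaces; an intrinsic package is $\mathcal D=(x_k^{(j)})_{k,j}$, $x_k^{(j)}\in X_k^{(j)}$, with norm $\|\mathcal D\|_{\mathrm{loc,int}}^2=\sum_{k}\sum_{j}a_j\|x_k^{(j)}\|^2$, $a_j>0$ fixed; $\mathfrak I_\Lambda^{\mathrm{loc}}$ is the space of intrinsic packages with this norm and $\Gamma_\Lambda^{\mathrm{int}}\subset\mathfrak I_\Lambda^{\mathrm{loc}}$ a linear subspace. Enhanced-tail distance. Let $B_r\subset\mathbb R^3$ be the ball of radius $r$ about $0$, $I=(-1,0)$, $Y_{\mathrm{prs}}=L^{3/2}(I;L^{3/2}(B_{1/2}))$, and $\mathsf R_i$ the Riesz transforms on $\mathbb R^3$ (tensors on $B_1$ are extended by zero, repeated indices summed, results restricted to $B_{1/2}$). Each package $\mathcal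 D$ carries a clean source tensor $F^{\mathrm{cl}}_{ij}(\mathcal D)=U_iU_j+R_{ij}\in L^{3/2}(I;L^{3/2}(B_1))$ built from its clean velocity and covariance coordinates $U,R$, and a harmonic pressure component $p_{\mathrm{harm}}(\mathcal D)$ in a normed space $Y_{\mathrm{harm}}$. $P_{\mathrm{prs},N}^{\mathrm{cl}}$ is a bounded linear projection on $Y_{\mathrm{prs}}$, $\Pi_{\mathrm{harm},M}$ a bounded projection of $Y_{\mathrm{harm}}$ onto a finite-dimensional subspace, $J_{\mathrm{harm}}:Y_{\mathrm{harm}}\to Y_{\mathrm{prs}}$ bounded linear. For $\zeta\in\Gamma_\Lambda^{\mathrm{int}}$, $\mathcal T_{\mathrm{proj}}(\mathcal D;\zeta)=(1+\|P_{\mathrm{prs},N}^{\mathrm{cl}}\|)\|\mathsf R_i\mathsf R_jF_{ij}^{\mathrm{cl}}(\mathcal D-\zeta)\|_{Y_{\mathrm{prs}}}$, $\mathcal T_{\mathrm{harm}}(\mathcal D;\zeta)=\|J_{\mathrm{harm}}\|\,\|(I-\Pi_{\mathrm{harm},M})p_{\mathrm{harm}}(\mathcal D-\zeta)\|_{Y_{\mathrm{harm}}}$. For fixed $\alpha_{\mathrm{proj}},\alpha_{\mathrm{harm}}>0$, $$\operatorname{dist}^{\sharp,\mathrm{tail}}(\mathcal D)=\inf_{\zeta\in\Gamma_\Lambda^{\mathrm{int}}}\big(\|\mathcal D-\zeta\|_{\mathrm{loc,int}}+\alpha_{\mathrm{proj}}\mathcal T_{\mathrm{proj}}(\mathcal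 D;\zeta)+\alpha_{\mathrm{harm}}\mathcal T_{\mathrm{harm}}(\mathcal D;\zeta)\big).$$ *)

theory Defs
  imports "HOL-Analysis.Analysis" "HOL-Library.Function_Algebras"
begin

instantiation "fun" :: (type, real_vector) real_vector
begin

definition scaleR_fun_def: "scaleR c f = (\<lambda>x. c *\<^sub>R f x)"

instance
  by standard (auto simp: scaleR_fun_def fun_eq_iff scaleR_add_right scaleR_add_left)

end

definition Lp_fun :: "real \<Rightarrow> 'a measure \<Rightarrow> ('a \<Rightarrow> real) set" where
  "Lp_fun p M = {f \<in> borel_measurable M. integrable M (\<lambda>x. \<bar>f x\<bar> powr p)}"

definition Lp_norm :: "real \<Rightarrow> 'a measure \<Rightarrow> ('a \<Rightarrow> real) \<Rightarrow> real" where
  "Lp_norm p M f = (LINT x|M. \<bar>f x\<bar> powr p) powr (1 / p)"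

lemma powr_convex_nonneg:
  fixes u v s t p :: real
  assumes "1 \<le> p" "0 \<le> u" "0 \<le> v" "0 \<le> s" "0 \<le> t" "s + t = 1"
  shows "(s * u + t * v) powr p \<le> s * u powr p + t * v powr p"
proof -
  have small: "(r * w) powr p \<le> r * w powr p" if "0 \<le> r" "r \<le> 1" "0 \<le> w" for r w :: real
  proof -
    have "r powr p \<le> r"
      using that \<open>1 \<le> p\<close> by (cases "r = 0") (use powr_mono'[of 1 p r] in auto)
    then show ?thesis
      using that by (simp add: powr_mult mult_right_mono)
  qed
  show ?thesis
  proof (cases "u = 0 \<or> v = 0")
    case True
    then show ?thesis using small[of t v] small[of s u] assms by auto
  next
    case False
    then have "u \<in> {0<..}" "v \<in> {0<..}" "s = 1 - t" using assms by auto
    then show ?thesis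
      using convex_onD[OF powr_convex[OF \<open>1 \<le> p\<close>], of t u v] assms
      by (simp add: \<open>s = 1 - t\<close>)
  qed
qed

lemma Lp_fun_scale:
  assumes "f \<in> Lp_fun p M"
  shows "(\<lambda>x. c * f x) \<in> Lp_fun p M"
  using assms by (auto simp: Lp_fun_def abs_mult powr_mult)

lemma Lp_norm_scale:
  assumes "1 \<le> p"
  shows "Lp_norm p M (\<lambda>x. c * f x) = \<bar>c\<bar> * Lp_norm p M f"
  using assms by (simp add: Lp_norm_def abs_mult powr_mult powr_powr)

lemma Lp_fun_add:
  assumes p: "1 \<le> p" and f: "f \<in> Lp_fun p M" and g: "g \<in> Lp_fun p M"
  shows "(\<lambda>x. f x + g x) \<in> Lp_fun p M"
proof -
  have [measurable]: "f \<in> borel_measurable M" "g \<in> borel_measurable M"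
    using f g by (auto simp: Lp_fun_def)
  have bound: "\<bar>a + b\<bar> powr p \<le> 2 powr p * (\<bar>a\<bar> powr p + \<bar>b\<bar> powr p)" for a b :: real
  proof -
    have "\<bar>a + b\<bar> powr p \<le> (2 * max \<bar>a\<bar> \<bar>b\<bar>) powr p"
      using p by (intro powr_mono2) auto
    also have "\<dots> = 2 powr p * (max \<bar>a\<bar> \<bar>b\<bar>) powr p"
      by (simp add: powr_mult)
    also have "\<dots> \<le> 2 powr p * (\<bar>a\<bar> powr p + \<bar>b\<bar> powr p)"
      by (intro mult_left_mono) (auto simp: max_def)
    finally show ?thesis .
  qed
  have "integrable M (\<lambda>x. 2 powr p * (\<bar>f x\<bar> powr p + \<bar>g x\<bar> powr p))"
    using f g by (auto simp: Lp_fun_def)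
  then have "integrable M (\<lambda>x. \<bar>f x + g x\<bar> powr p)"
    by (rule Bochner_Integration.integrable_bound) (use bound in \<open>auto intro!: AE_I2\<close>)
  then show ?thesis by (auto simp: Lp_fun_def)
qed

lemma Lp_norm_cong_AE:
  assumes "f \<in> borel_measurable M" "g \<in> borel_measurable M" "AE x in M. f x = g x"
  shows "Lp_norm p M f = Lp_norm p M g"
proof -
  have "(LINT x|M. \<bar>f x\<bar> powr p) = (LINT x|M. \<bar>g x\<bar> powr p)"
    using assms by (intro integral_cong_AE) auto
  then show ?thesis by (simp add: Lp_norm_def)
qed

lemma Lp_norm_nonneg: "0 \<le> Lp_norm p M f"
  by (simp add: Lp_norm_def)

lemma Lp_norm_eq_0_iff:
  assumes "1 \<le> p" "f \<in> Lp_fun p M"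
  shows "Lp_norm p M f = 0 \<longleftrightarrow> (AE x in M. f x = 0)"
proof -
  have "Lp_norm p M f = 0 \<longleftrightarrow> (LINT x|M. \<bar>f x\<bar> powr p) = 0"
    by (simp add: Lp_norm_def)
  also have "\<dots> \<longleftrightarrow> (AE x in M. \<bar>f x\<bar> powr p = 0)"
    using assms by (intro integral_nonneg_eq_0_iff_AE) (auto simp: Lp_fun_def)
  finally show ?thesis by simp
qed

lemma Lp_norm_powr:
  assumes "1 \<le> p"
  shows "(LINT x|M. \<bar>f x\<bar> powr p) = Lp_norm p M f powr p"
  using assms by (simp add: Lp_norm_def powr_powr)

lemma Lp_norm_triangle:
  assumes p: "1 \<le> p" and f: "f \<in> Lp_fun p M" and g: "g \<in> Lp_fun p M"
  shows "Lp_norm p M (\<lambda>x. f x + g x) \<le> Lp_norm p M f + Lp_norm p M g"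
proof -
  define a b where "a = Lp_norm p M f" and "b = Lp_norm p M g"
  have [measurable]: "f \<in> borel_measurable M" "g \<in> borel_measurable M"
    using f g by (auto simp: Lp_fun_def)
  have ab: "0 \<le> a" "0 \<le> b" by (auto simp: a_def b_def Lp_norm_nonneg)
  consider "a = 0" | "b = 0" | "0 < a" "0 < b" using ab by linarith
  then show ?thesis
  proof cases
    case 1
    then have "AE x in M. f x = 0" using Lp_norm_eq_0_iff[OF p f] by (simp add: a_def)
    then have "Lp_norm p M (\<lambda>x. f x + g x) = Lp_norm p M g"
      by (intro Lp_norm_cong_AE) auto
    then show ?thesis using ab by (simp add: a_def)
  next
    case 2
    then have "AE x in M. g x = 0" using Lp_norm_eq_0_iff[OF p g] by (simp add: b_def)
    then have "Lp_norm p M (\<lambda>x. f x + g x) = Lp_norm p M f"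
      by (intro Lp_norm_cong_AE) auto
    then show ?thesis using ab by (simp add: b_def)
  next
    case 3
    define s t where "s = a / (a + b)" and "t = b / (a + b)"
    have st: "0 \<le> s" "0 \<le> t" "s + t = 1"
      using 3 by (auto simp: s_def t_def add_divide_distrib[symmetric])
    let ?h = "\<lambda>x. (a + b) powr p *
      (s / a powr p * \<bar>f x\<bar> powr p + t / b powr p * \<bar>g x\<bar> powr p)"
    have pw: "\<bar>f x + g x\<bar> powr p \<le> ?h x" for x
    proof -
      have sa: "s * (\<bar>f x\<bar> / a) = \<bar>f x\<bar> / (a + b)" and tb: "t * (\<bar>g x\<bar> / b) = \<bar>g x\<bar> / (a + b)"
        using 3 by (auto simp: s_def t_def)
      have "\<bar>f x + g x\<bar> powr p \<le> (\<bar>f x\<bar> + \<bar>g x\<bar>) powr p"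
        using p by (intro powr_mono2) auto
      also have "\<bar>f x\<bar> + \<bar>g x\<bar> = (a + b) * (s * (\<bar>f x\<bar> / a) + t * (\<bar>g x\<bar> / b))"
        unfolding sa tb using 3 by (simp add: add_divide_distrib[symmetric])
      also have "\<dots> powr p = (a + b) powr p * (s * (\<bar>f x\<bar> / a) + t * (\<bar>g x\<bar> / b)) powr p"
        by (rule powr_mult)
      also have "\<dots> \<le> (a + b) powr p * (s * (\<bar>f x\<bar> / a) powr p + t * (\<bar>g x\<bar> / b) powr p)"
        using 3 st p by (intro mult_left_mono powr_convex_nonneg) auto
      also have "\<dots> = ?h x"
        using 3 by (simp add: powr_divide)
      finally show ?thesis .
    qed
    have fi: "integrable M (\<lambda>x. \<bar>f x\<bar> powr p)" and gi: "integrable M (\<lambda>x. \<bar>g x\<bar> powr p)"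
      using f g by (auto simp: Lp_fun_def)
    have "(LINT x|M. \<bar>f x + g x\<bar> powr p) \<le> (LINT x|M. ?h x)"
      using Lp_fun_add[OF p f g] fi gi pw by (intro integral_mono) (auto simp: Lp_fun_def)
    also have "\<dots> = (a + b) powr p * (s / a powr p * a powr p + t / b powr p * b powr p)"
      using fi gi by (simp add: Lp_norm_powr[OF p] a_def b_def)
    also have "\<dots> = (a + b) powr p" using 3 st by simp
    finally have "Lp_norm p M (\<lambda>x. f x + g x) \<le> ((a + b) powr p) powr (1 / p)"
      unfolding Lp_norm_def[of p M "\<lambda>x. f x + g x"] using p by (intro powr_mono2) auto
    also have "\<dots> = a + b" using p 3 by (simp add: powr_powr)
    finally show ?thesis by (simp add: a_def b_def)
  qed
qed

text \<open>
  A space-time field is a function of \<open>(t, x)\<close>. By Tonelli, \<open>L^p(I; L^p(B))\<close> is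
  \<open>L^p(I \<times> B)\<close>, with the same norm.
\<close>

definition cyl :: "real \<Rightarrow> (real \<times> (real ^ 3)) measure" where
  "cyl r = lebesgue_on ({-1 <..< 0} \<times> ball 0 r)"

definition prs_rel :: "(real \<times> (real ^ 3) \<Rightarrow> real) \<Rightarrow> (real \<times> (real ^ 3) \<Rightarrow> real) \<Rightarrow> bool" where
  "prs_rel f g \<longleftrightarrow> f \<in> Lp_fun (3/2) (cyl (1/2)) \<and> g \<in> Lp_fun (3/2) (cyl (1/2)) \<and>
     (AE z in cyl (1/2). f z = g z)"

lemma zero_in_Lp_fun: "(\<lambda>x. 0) \<in> Lp_fun p M"
  by (simp add: Lp_fun_def)

text \<open>\<open>Y_prs = L^(3/2)(I; L^(3/2)(B_(1/2)))\<close>\<close>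

quotient_type yprs = "real \<times> (real ^ 3) \<Rightarrow> real" / partial: prs_rel
proof (rule part_equivpI)
  show "\<exists>f. prs_rel f f"
    by (rule exI[of _ "\<lambda>z. 0"]) (simp add: prs_rel_def zero_in_Lp_fun)
  show "symp prs_rel"
    by (rule sympI) (auto simp: prs_rel_def elim: eventually_mono)
  show "transp prs_rel"
    by (rule transpI) (auto simp: prs_rel_def elim: eventually_elim2)
qed

lemma prs_rel_measurable:
  assumes "prs_rel f g"
  shows "f \<in> borel_measurable (cyl (1/2))" "g \<in> borel_measurable (cyl (1/2))"
  using assms by (auto simp: prs_rel_def Lp_fun_def)

instantiation yprs :: real_normed_vector
begin

lift_definition zero_yprs :: yprs is "\<lambda>z. 0"
  by (simp add: prs_rel_def zero_in_Lp_fun)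

lift_definition plus_yprs :: "yprs \<Rightarrow> yprs \<Rightarrow> yprs" is "\<lambda>f g z. f z + g z"
  by (auto simp: prs_rel_def Lp_fun_add elim: eventually_elim2)

lift_definition scaleR_yprs :: "real \<Rightarrow> yprs \<Rightarrow> yprs" is "\<lambda>c f z. c * f z"
  by (auto simp: prs_rel_def Lp_fun_scale elim: eventually_mono)

lift_definition norm_yprs :: "yprs \<Rightarrow> real" is "Lp_norm (3/2) (cyl (1/2))"
  using prs_rel_measurable by (auto simp: prs_rel_def intro!: Lp_norm_cong_AE)

definition uminus_yprs :: "yprs \<Rightarrow> yprs" where "uminus_yprs f = (-1) *\<^sub>R f"
definition minus_yprs :: "yprs \<Rightarrow> yprs \<Rightarrow> yprs" where "minus_yprs f g = f + (-1) *\<^sub>R g"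
definition dist_yprs :: "yprs \<Rightarrow> yprs \<Rightarrow> real" where "dist_yprs f g = norm (f - g)"
definition sgn_yprs :: "yprs \<Rightarrow> yprs" where "sgn_yprs f = inverse (norm f) *\<^sub>R f"
definition uniformity_yprs :: "(yprs \<times> yprs) filter" where
  "uniformity_yprs = (INF e\<in>{0 <..}. principal {(x, y). dist x y < e})"
definition open_yprs :: "yprs set \<Rightarrow> bool" where
  "open_yprs U \<longleftrightarrow> (\<forall>x\<in>U. eventually (\<lambda>(x', y). x' = x \<longrightarrow> y \<in> U) uniformity)"

instance
proof
  fix f g h :: yprs and c d :: real
  show "f + g + h = f + (g + h)"
    by transfer (auto simp: prs_rel_def Lp_fun_add)
  show "f + g = g + f"
    by transfer (auto simp: prs_rel_def Lp_fun_add)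
  show "0 + f = f"
    by transfer (auto simp: prs_rel_def)
  show "- f + f = 0"
    unfolding uminus_yprs_def
    by transfer (auto simp: prs_rel_def Lp_fun_add Lp_fun_scale zero_in_Lp_fun)
  show "f - g = f + - g"
    by (simp add: uminus_yprs_def minus_yprs_def)
  show "c *\<^sub>R (f + g) = c *\<^sub>R f + c *\<^sub>R g"
    by transfer (auto simp: prs_rel_def Lp_fun_add Lp_fun_scale algebra_simps)
  show "(c + d) *\<^sub>R f = c *\<^sub>R f + d *\<^sub>R f"
    by transfer (auto simp: prs_rel_def Lp_fun_add Lp_fun_scale algebra_simps)
  show "c *\<^sub>R d *\<^sub>R f = (c * d) *\<^sub>R f"
    by transfer (auto simp: prs_rel_def Lp_fun_scale algebra_simps)
  show "1 *\<^sub>R f = f"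
    by transfer (auto simp: prs_rel_def)
  show "dist f g = norm (f - g)" by (simp add: dist_yprs_def)
  show "sgn f = inverse (norm f) *\<^sub>R f" by (simp add: sgn_yprs_def)
  show "uniformity = (INF e\<in>{0 <..}. principal {(x, y :: yprs). dist x y < e})"
    by (simp add: uniformity_yprs_def)
  show "open U \<longleftrightarrow> (\<forall>x\<in>U. eventually (\<lambda>(x', y). x' = x \<longrightarrow> y \<in> U) uniformity)"
    for U :: "yprs set" by (simp add: open_yprs_def)
  show "norm f = 0 \<longleftrightarrow> f = 0"
    by transfer (auto simp: prs_rel_def Lp_norm_eq_0_iff zero_in_Lp_fun)
  show "norm (f + g) \<le> norm f + norm g"
    by transfer (auto simp: prs_rel_def intro!: Lp_norm_triangle)
  show "norm (c *\<^sub>R f) = \<bar>c\<bar> * norm f"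
    by transfer (simp add: Lp_norm_scale)
qed

end

text \<open>
  Principal value with respect to the kernel
  \<open>\<Gamma>((n+1)/2) \<pi>^(-(n+1)/2) y_j / |y|^(n+1)\<close> on \<open>R^n\<close>, \<open>n = 3\<close>.
  For \<open>f \<in> L^p\<close>, \<open>1 < p < \<infinity>\<close>, the limit exists for almost every \<open>x\<close>; where it does
  not exist the value is set to 0.
\<close>

definition riesz_trunc :: "3 \<Rightarrow> real \<Rightarrow> (real ^ 3 \<Rightarrow> real) \<Rightarrow> real ^ 3 \<Rightarrow> real" where
  "riesz_trunc j e f x =
     (LINT y:{y. e < norm y}|lebesgue. 1 / pi\<^sup>2 * (y $ j / norm y ^ 4) * f (x - y))"

definition riesz :: "3 \<Rightarrow> (real ^ 3 \<Rightarrow> real) \<Rightarrow> real ^ 3 \<Rightarrow> real" where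
  "riesz j f x =
     (if \<exists>l. ((\<lambda>e. riesz_trunc j e f x) \<longlongrightarrow> l) (at_right 0)
      then Lim (at_right 0) (\<lambda>e. riesz_trunc j e f x) else 0)"

type_synonym tensor_field = "real \<times> (real ^ 3) \<Rightarrow> real ^ 3 ^ 3"

definition double_riesz :: "tensor_field \<Rightarrow> real \<times> (real ^ 3) \<Rightarrow> real" where
  "double_riesz F = (\<lambda>(t, x). \<Sum>i\<in>UNIV. \<Sum>j\<in>UNIV.
     riesz i (riesz j (\<lambda>y. if y \<in> ball 0 1 then F (t, y) $ i $ j else 0)) x)"

text \<open>
  The class in \<open>Y_prs\<close>; by Calderon--Zygmund the field belongs to \<open>L^(3/2)\<close> whenever \<open>F\<close> does.
\<close>

definition riesz_pressure :: "tensor_field \<Rightarrow> yprs" where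
  "riesz_pressure F = abs_yprs (double_riesz F)"

text \<open>
  The finitely many normed spaces \<open>X k j\<close> are subspaces of one normed space \<open>'x\<close>. This is no
  restriction: a finite family of normed spaces embeds isometrically into its direct sum.
  A package is extended by zero outside \<open>\<Lambda> \<times> {1..7}\<close>.
\<close>

type_synonym 'x package = "int \<Rightarrow> nat \<Rightarrow> 'x"

definition packages ::
  "int set \<Rightarrow> (int \<Rightarrow> nat \<Rightarrow> 'x::real_normed_vector set) \<Rightarrow> 'x package set" where
  "packages \<Lambda> X = {D. (\<forall>k\<in>\<Lambda>. \<forall>j\<in>{1..7}. D k j \<in> X k j) \<and>
     (\<forall>k j. k \<notin> \<Lambda> \<or> j \<notin> {1..7} \<longrightarrow> D k j = 0)}"

definition norm_loc ::
  "int set \<Rightarrow> (nat \<Rightarrow> real) \<Rightarrow> 'x::real_normed_vector package \<Rightarrow> real" where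
  "norm_loc \<Lambda> a D = sqrt (\<Sum>k\<in>\<Lambda>. \<Sum>j=1..7. a j * (norm (D k j))\<^sup>2)"

definition bounded_linear_from ::
  "'x::real_normed_vector package set \<Rightarrow> ('x package \<Rightarrow> real) \<Rightarrow>
   ('x package \<Rightarrow> 'y::real_normed_vector) \<Rightarrow> bool" where
  "bounded_linear_from V nrm K \<longleftrightarrow>
     (\<forall>D\<in>V. \<forall>E\<in>V. K (D + E) = K D + K E) \<and>
     (\<forall>c. \<forall>D\<in>V. K (c *\<^sub>R D) = c *\<^sub>R K D) \<and>
     (\<exists>C. \<forall>D\<in>V. norm (K D) \<le> C * nrm D)"

text \<open>As for \<^const>\<open>onorm\<close>, the zero package contributes \<open>0 / 0 = 0\<close>.\<close>

definition onorm_from ::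
  "'x::real_normed_vector package set \<Rightarrow> ('x package \<Rightarrow> real) \<Rightarrow>
   ('x package \<Rightarrow> 'y::real_normed_vector) \<Rightarrow> real" where
  "onorm_from V nrm K = (SUP D\<in>V. norm (K D) / nrm D)"

definition projection :: "('b::real_normed_vector \<Rightarrow> 'b) \<Rightarrow> bool" where
  "projection P \<longleftrightarrow> bounded_linear P \<and> P \<circ> P = P"

definition finite_dim :: "'b::real_vector set \<Rightarrow> bool" where
  "finite_dim V \<longleftrightarrow> (\<exists>B. finite B \<and> V = span B)"

text \<open>
  \<open>U D\<close> and \<open>R D\<close> are representatives of the clean velocity and covariance fields of the
  package \<open>D\<close>; no particular dependence on \<open>D\<close> is assumed.
\<close>

definition clean_source ::
  "('x package \<Rightarrow> real \<times> (real ^ 3) \<Rightarrow> real ^ 3) \<Rightarrow> ('x package \<Rightarrow> tensor_field) \<Rightarrow>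
   'x package \<Rightarrow> tensor_field" where
  "clean_source U R D = (\<lambda>z. \<chi> i j. U D z $ i * U D z $ j + R D z $ i $ j)"

definition T_proj ::
  "(yprs \<Rightarrow> yprs) \<Rightarrow> ('x::real_normed_vector package \<Rightarrow> tensor_field) \<Rightarrow>
   'x package \<Rightarrow> 'x package \<Rightarrow> real" where
  "T_proj P F D \<zeta> = (1 + onorm P) * norm (riesz_pressure (F (D - \<zeta>)))"

definition T_harm ::
  "('h::real_normed_vector \<Rightarrow> yprs) \<Rightarrow> ('h \<Rightarrow> 'h) \<Rightarrow> ('x::real_normed_vector package \<Rightarrow> 'h) \<Rightarrow>
   'x package \<Rightarrow> 'x package \<Rightarrow> real" where
  "T_harm J Q p D \<zeta> = onorm J * norm (p (D - \<zeta>) - Q (p (D - \<zeta>)))"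

definition tail_functional ::
  "('x::real_normed_vector package \<Rightarrow> real) \<Rightarrow> real \<Rightarrow> ('x package \<Rightarrow> 'x package \<Rightarrow> real) \<Rightarrow>
   real \<Rightarrow> ('x package \<Rightarrow> 'x package \<Rightarrow> real) \<Rightarrow> 'x package \<Rightarrow> 'x package \<Rightarrow> real" where
  "tail_functional nrm \<alpha>proj Tproj \<alpha>harm Tharm D \<zeta> =
     nrm (D - \<zeta>) + \<alpha>proj * Tproj D \<zeta> + \<alpha>harm * Tharm D \<zeta>"

definition dist_tail ::
  "('x package \<Rightarrow> 'x package \<Rightarrow> real) \<Rightarrow> 'x package set \<Rightarrow> 'x package \<Rightarrow> real" where
  "dist_tail \<Phi> \<Gamma> D = (INF \<zeta>\<in>\<Gamma>. \<Phi> D \<zeta>)"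

definition selector_with_defect ::
  "('x package \<Rightarrow> 'x package \<Rightarrow> real) \<Rightarrow> 'x package set \<Rightarrow> 'x package set \<Rightarrow>
   ('x package \<Rightarrow> 'x package) \<Rightarrow> real \<Rightarrow> bool" where
  "selector_with_defect \<Phi> V \<Gamma> sel \<delta> \<longleftrightarrow>
     0 \<le> \<delta> \<and> (\<forall>D\<in>V. \<Phi> D (sel D) \<le> dist_tail \<Phi> \<Gamma> D + \<delta>)"

definition adjacent :: "int set \<Rightarrow> int set" where
  "adjacent \<Lambda> = {k \<in> \<Lambda>. k + 1 \<in> \<Lambda>}"

definition drift_residual ::
  "int set \<Rightarrow> (int \<Rightarrow> 'x::real_normed_vector package \<Rightarrow> 'y::real_normed_vector) \<Rightarrow>
   ('x package \<Rightarrow> 'x package) \<Rightarrow> 'x package \<Rightarrow> real" where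
  "drift_residual \<Lambda> K sel D = (\<Sum>k\<in>adjacent \<Lambda>. norm (K k (D - sel D)))"

end

theory Submission
  imports Defs
begin

text \<open>The two tail terms in the enhanced functional are nonnegative, so the local norm of the
  residual \<open>D - sel D\<close> is at most the functional at \<open>sel D\<close>, hence at most
  the tail distance plus the selector defect (\<open>norm_le_tail_functional\<close>). Each
  reproduction operator is bounded by its operator norm times that local norm
  (\<open>norm_le_onorm_from\<close>); summing over adjacent indices produces the factor
  \<open>C_rep\<close> (\<open>drift_residual_le\<close>). An exact minimizer attains the infimum,
  so its defect is 0 (\<open>selector_with_defect_0\<close>).\<close>

lemma norm_loc_nonneg:
  assumes "\<And>j. j \<in> {1..7} \<Longrightarrow> 0 \<le> a j"
  shows "0 \<le> norm_loc \<Lambda> a D"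
  unfolding norm_loc_def using assms by (intro real_sqrt_ge_zero sum_nonneg mult_nonneg_nonneg) auto

lemma packages_diff:
  assumes "\<And>k j. k \<in> \<Lambda> \<Longrightarrow> j \<in> {1..7} \<Longrightarrow> subspace (X k j)"
    and "D \<in> packages \<Lambda> X" "E \<in> packages \<Lambda> X"
  shows "D - E \<in> packages \<Lambda> X"
  using assms by (auto simp: packages_def intro!: subspace_diff)

text \<open>A supremum of reals is informative only for a set bounded above; this is what makes
  \<open>onorm_from\<close> a genuine operator norm.\<close>

lemma bounded_linear_from_bdd_above:
  assumes "bounded_linear_from V nrm K" and nrm: "\<And>D. D \<in> V \<Longrightarrow> 0 \<le> nrm D"
  shows "bdd_above ((\<lambda>D. norm (K D) / nrm D) ` V)"
proof -
  obtain C where C: "norm (K D) \<le> C * nrm D" if "D \<in> V" for D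
    using assms(1) unfolding bounded_linear_from_def by blast
  \<comment> \<open>The absolute value covers a negative \<open>C\<close>: where
    \<open>nrm D = 0\<close> the quotient is 0, which need not be below \<open>C\<close>.\<close>
  have "norm (K D) / nrm D \<le> \<bar>C\<bar>" if "D \<in> V" for D
  proof (cases "nrm D = 0")
    case False
    then have "0 < nrm D" using nrm[OF that] by simp
    then have "norm (K D) / nrm D \<le> C" using C[OF that] by (simp add: pos_divide_le_eq)
    then show ?thesis by linarith
  qed simp
  then show ?thesis by (intro bdd_aboveI2)
qed

text \<open>The element \<open>D\<close> makes the supremum run over a nonempty set, and its own
  quotient is a nonnegative lower estimate.\<close>

lemma onorm_from_nonneg:
  assumes "bounded_linear_from V nrm K" and nrm: "\<And>D. D \<in> V \<Longrightarrow> 0 \<le> nrm D" and D: "D \<in> V"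
  shows "0 \<le> onorm_from V nrm K"
proof -
  have "0 \<le> norm (K D) / nrm D" using nrm[OF D] by simp
  also have "\<dots> \<le> onorm_from V nrm K"
    unfolding onorm_from_def
    by (intro cSUP_upper D bounded_linear_from_bdd_above assms(1) nrm)
  finally show ?thesis .
qed

lemma norm_le_onorm_from:
  assumes "bounded_linear_from V nrm K" and nrm: "\<And>D. D \<in> V \<Longrightarrow> 0 \<le> nrm D" and D: "D \<in> V"
  shows "norm (K D) \<le> onorm_from V nrm K * nrm D"
proof (cases "nrm D = 0")
  \<comment> \<open>Here the quotient is 0 by convention and says nothing about \<open>K D\<close>;
    the bound \<open>C * nrm D\<close> itself forces \<open>K D = 0\<close>.\<close>
  case True
  obtain C where "norm (K D) \<le> C * nrm D"
    using assms(1) D unfolding bounded_linear_from_def by blast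
  then show ?thesis using True by simp
next
  case False
  then have "0 < nrm D" using nrm[OF D] by simp
  moreover have "norm (K D) / nrm D \<le> onorm_from V nrm K"
    unfolding onorm_from_def
    by (intro cSUP_upper D bounded_linear_from_bdd_above assms(1) nrm)
  ultimately show ?thesis by (simp add: pos_divide_le_eq)
qed

text \<open>Both tail terms are products of nonnegative factors; boundedness of \<open>P\<close> and
  \<open>J\<close> enters because it makes their \<open>onorm\<close> nonnegative.\<close>

lemma norm_le_tail_functional:
  assumes "bounded_linear P" "bounded_linear J" "0 \<le> \<alpha>proj" "0 \<le> \<alpha>harm"
  shows "nrm (D - \<zeta>) \<le> tail_functional nrm \<alpha>proj (T_proj P F) \<alpha>harm (T_harm J Q p) D \<zeta>"
proof -
  have "0 \<le> \<alpha>proj * T_proj P F D \<zeta>" "0 \<le> \<alpha>harm * T_harm J Q p D \<zeta>"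
    using assms by (auto simp: T_proj_def T_harm_def onorm_pos_le)
  then show ?thesis by (simp add: tail_functional_def)
qed

lemma drift_residual_le:
  assumes "\<And>k. k \<in> adjacent \<Lambda> \<Longrightarrow> bounded_linear_from V nrm (K k)"
    and "\<And>D. D \<in> V \<Longrightarrow> 0 \<le> nrm D" and "D - sel D \<in> V" and "nrm (D - sel D) \<le> d"
  shows "drift_residual \<Lambda> K sel D \<le> (\<Sum>k\<in>adjacent \<Lambda>. onorm_from V nrm (K k)) * d"
proof -
  have "drift_residual \<Lambda> K sel D \<le> (\<Sum>k\<in>adjacent \<Lambda>. onorm_from V nrm (K k) * nrm (D - sel D))"
    unfolding drift_residual_def by (intro sum_mono norm_le_onorm_from assms(1-3))
  \<comment> \<open>Replacing the norm by \<open>d\<close> needs nonnegative operator norms;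
    \<open>D - sel D\<close> witnesses that \<open>V\<close> is nonempty.\<close>
  also have "\<dots> \<le> (\<Sum>k\<in>adjacent \<Lambda>. onorm_from V nrm (K k) * d)"
    by (intro sum_mono mult_left_mono onorm_from_nonneg[OF assms(1,2) assms(3)] assms(4))
  finally show ?thesis by (simp add: sum_distrib_right)
qed

text \<open>The value at a minimizer is a lower bound of \<open>\<Phi> D\<close> on
  \<open>\<Gamma>\<close>, hence at most the infimum; \<open>sel D\<close> itself shows that
  \<open>\<Gamma>\<close> is nonempty.\<close>

lemma selector_with_defect_0:
  assumes "\<And>D. D \<in> V \<Longrightarrow> is_arg_min (\<Phi> D) (\<lambda>\<zeta>. \<zeta> \<in> \<Gamma>) (sel D)"
  shows "selector_with_defect \<Phi> V \<Gamma> sel 0"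
proof -
  have "\<Phi> D (sel D) \<le> dist_tail \<Phi> \<Gamma> D" if "D \<in> V" for D
    unfolding dist_tail_def using assms[OF that]
    by (intro cINF_greatest) (auto simp: is_arg_min_linorder)
  then show ?thesis by (simp add: selector_with_defect_def)
qed

text \<open>The defect is quantified inside the conclusion, so the exact-minimizer claim is the same
  estimate taken at defect 0.\<close>

theorem proposition9p130:
  fixes \<Lambda> :: "int set"
    and X :: "int \<Rightarrow> nat \<Rightarrow> 'x::real_normed_vector set"
    and a :: "nat \<Rightarrow> real"
    and \<Gamma> :: "'x package set"
    and U :: "'x package \<Rightarrow> real \<times> (real ^ 3) \<Rightarrow> real ^ 3"
    and R :: "'x package \<Rightarrow> tensor_field"
    and P :: "yprs \<Rightarrow> yprs"
    and p_harm :: "'x package \<Rightarrow> 'h::real_normed_vector"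
    and Q :: "'h \<Rightarrow> 'h"
    and J :: "'h \<Rightarrow> yprs"
    and \<alpha>proj \<alpha>harm :: real
    and sel :: "'x package \<Rightarrow> 'x package"
    and Y :: "int \<Rightarrow> 'y::real_normed_vector set"
    and K :: "int \<Rightarrow> 'x package \<Rightarrow> 'y"
  defines "V \<equiv> packages \<Lambda> X"
    and "\<Phi> \<equiv> tail_functional (norm_loc \<Lambda> a)
               \<alpha>proj (T_proj P (clean_source U R)) \<alpha>harm (T_harm J Q p_harm)"
    and "C_rep \<equiv> (\<Sum>k\<in>adjacent \<Lambda>. onorm_from (packages \<Lambda> X) (norm_loc \<Lambda> a) (K k))"
  assumes "\<exists>m n. \<Lambda> = {m..n}"
    and "\<And>k j. k \<in> \<Lambda> \<Longrightarrow> j \<in> {1..7} \<Longrightarrow> subspace (X k j)"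
    and "\<And>j. j \<in> {1..7} \<Longrightarrow> 0 < a j"
    and "\<Gamma> \<subseteq> V" "subspace \<Gamma>"
    and "\<And>D i j. D \<in> V \<Longrightarrow> (\<lambda>z. clean_source U R D z $ i $ j) \<in> Lp_fun (3/2) (cyl 1)"
    and "projection P"
    and "projection Q" "finite_dim (range Q)"
    and "bounded_linear J"
    and "0 < \<alpha>proj" "0 < \<alpha>harm"
    and "\<And>D. D \<in> V \<Longrightarrow> sel D \<in> \<Gamma>"
    and "\<And>k. k \<in> adjacent \<Lambda> \<Longrightarrow> subspace (Y k) \<and> finite_dim (Y k)"
    and "\<And>k. k \<in> adjacent \<Lambda> \<Longrightarrow> K k ` V \<subseteq> Y k \<and> bounded_linear_from V (norm_loc \<Lambda> a) (K k)"
  shows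
    "(\<forall>\<delta>. selector_with_defect \<Phi> V \<Gamma> sel \<delta> \<longrightarrow>
        (\<forall>D\<in>V. drift_residual \<Lambda> K sel D \<le> C_rep * dist_tail \<Phi> \<Gamma> D + C_rep * \<delta>)) \<and>
     ((\<forall>D\<in>V. is_arg_min (\<Phi> D) (\<lambda>\<zeta>. \<zeta> \<in> \<Gamma>) (sel D)) \<longrightarrow>
        selector_with_defect \<Phi> V \<Gamma> sel 0 \<and>
        (\<forall>D\<in>V. drift_residual \<Lambda> K sel D \<le> C_rep * dist_tail \<Phi> \<Gamma> D))"
proof -
  have nrm: "0 \<le> norm_loc \<Lambda> a D" for D :: "'x package"
    using assms(6) by (intro norm_loc_nonneg) (auto intro: less_imp_le)
  have bound: "drift_residual \<Lambda> K sel D \<le> C_rep * dist_tail \<Phi> \<Gamma> D + C_rep * \<delta>"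
    if sel: "selector_with_defect \<Phi> V \<Gamma> sel \<delta>" and D: "D \<in> V" for \<delta> D
  proof -
    \<comment> \<open>The operator bounds hold only on \<open>V\<close>, so the residual must again
      be a package: \<open>\<Gamma>\<close> lies in \<open>V\<close>, and the fibres
      \<open>X k j\<close> are closed under differences.\<close>
    have "D - sel D \<in> V"
      unfolding V_def using assms(5) D \<open>\<Gamma> \<subseteq> V\<close> \<open>\<And>D. D \<in> V \<Longrightarrow> sel D \<in> \<Gamma>\<close>
      by (intro packages_diff) (auto simp: V_def)
    moreover have "norm_loc \<Lambda> a (D - sel D) \<le> dist_tail \<Phi> \<Gamma> D + \<delta>"
    proof -
      have "norm_loc \<Lambda> a (D - sel D) \<le> \<Phi> D (sel D)"
        unfolding \<Phi>_def
        using \<open>projection P\<close> \<open>bounded_linear J\<close> \<open>0 < \<alpha>proj\<close> \<open>0 < \<alpha>harm\<close>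
        by (intro norm_le_tail_functional) (auto simp: projection_def)
      also have "\<dots> \<le> dist_tail \<Phi> \<Gamma> D + \<delta>"
        using sel D by (simp add: selector_with_defect_def)
      finally show ?thesis .
    qed
    ultimately have "drift_residual \<Lambda> K sel D \<le> C_rep * (dist_tail \<Phi> \<Gamma> D + \<delta>)"
      unfolding C_rep_def V_def[symmetric]
      using assms(18) nrm by (intro drift_residual_le) blast+
    then show ?thesis by (simp add: distrib_left)
  qed
  moreover have "drift_residual \<Lambda> K sel D \<le> C_rep * dist_tail \<Phi> \<Gamma> D"
    if "selector_with_defect \<Phi> V \<Gamma> sel 0" "D \<in> V" for D
    using bound[OF that] by simp
  ultimately show ?thesis
    using selector_with_defect_0[of V \<Phi> \<Gamma> sel] by blast
qed

end
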